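(* Let $V\in C^2(\mathbb{R}^d)$ be a sub-exponential norm-like function such that, for each $n$ and all $x\in\widehat{E}^n$, $$\mathbb{E}_x\Big[\int_0^t\big((1+|\widehat{X}^n(s)|)^4V(\widehat{X}^n(s))\big)^2ds\Big]<\infty,\qquad t\ge0,$$ and such that, for some constant $\eta>0$ (not depending on $n$) and all $n$, $$V(x)>V(0)\quad\text{and}\quad \widehat{F}^n(x)'DV(x)\le-\eta\,(V(x)-V(0)),\qquad x\ne0 .$$ If $$\limsup_{|x|\to\infty}\frac{|D^2V(x)|}{V(x)}=0,$$ then there exist finite positive constants $b,\delta,K$ (not depending on $n$) such that for all $n$ $$\mathcal{A}^nV(x)\le-\delta V(x)+b\,\mathbf{1}_{\overline{B}_0(K)}(x)\qquad\text{for all }x\in\mathbb{R}^d,$$ and, in turn, $V$ satisfies the uniform Lyapunov assumption (UL-A) stated in the context.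
   Context: Setting. For each $n\in\mathbb{N}$, $X^n$ is a continuous time Markov chain (CTMC) on a countable state space $E^n\subset\mathbb{R}^d$, with transition rates $\beta^n_{y-x}(x)=q^n_{x,y}$, $x,y\in E^n$ (so $\beta^n_\ell(x)$ is the rate of a jump $\ell$ from state $x$). Put $F^n(x)=\sum_\ell \ell\,\beta^n_\ell(x)$ and $a^n_{ij}(x)=\sum_\ell \ell_i\ell_j\beta^n_\ell(x)$ for $x\in E^n$; $F^n$ and $a^n$ are extended to $\mathbb{R}^d$, the extensions being part of the data and denoted the same way. There is a unique $\bar{x}^n_\infty\in\mathbb{R}^d$ with $F^n(\bar{x}^n_\infty)=0$. Define $\widehat{X}^n=(X^n-\bar{x}^n_\infty)/\sqrt{n}$, with state space $\widehat{E}^n$, and, for $x\in\mathbb{R}^d$, $\widehat{F}^n(x)=F^n(\bar{x}^n_\infty+\sqrt{n}x)/\sqrt{n}$, $\bar{a}^n(x)=a^n(\bar{x}^n_\infty+\sqrt{n}x)/n$. Standing assumptions. For each $n$, $X^n$ is nonexplosive, irreducible and positive recurrent; jump sizes are uniformly bounded: $\bar\ell=\sup\{|\ell|:\beta^n_\ell(x)>0\text{ for some }n,\ x\in E^n\}<\infty$, and $n$ is taken large enough that $\bar\ell/\sqrt{n}\le 1$; there are constants $K_F,K_a$ with, for all $n$ and $x,y\in\mathbb{R}^d$, $|\widehat{F}^n(x)-\widehat{F}^n(y)|\le K_F|x-y|$ and $|\bar{a}^n(x)-\bar{a}^n(0)|\le \frac{K_a}{\sqrt n}|x|$; $\bar{a}^n(0)$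 is positive definite for each $n$ and $\bar{a}^n(0)\to\bar{a}$ with $\bar a$ positive definite. For $f\in C^2(\mathbb{R}^d)$, $\mathcal{A}^nf(x)=\sum_{i}\widehat{F}^n_i(x)\frac{\partial f}{\partial x_i}(x)+\frac12\sum_{i,j}\bar{a}^n_{ij}(0)\frac{\partial^2 f}{\partial x_i\partial x_j}(x)$. Definitions. $V\in C^2(\mathbb{R}^d)$ is norm-like if $V(x)\to\infty$ as $|x|\to\infty$. $V\in C^2(\mathbb{R}^d)$ is sub-exponential if $V\ge1$ and there are constants $c_1,c_2,c_3$ with $|DV(x)|\vee|D^2V(x)|\le c_1e^{c_2|x|}$ and $\sup_{|y|\le1}V(x+y)/V(x)\le c_3$ for all $x\in\mathbb{R}^d$. $\overline{B}_x(M)$ is the closed Euclidean ball of radius $M$ about $x$. Assumption (UL-A) on $V$: $V\in C^2(\mathbb{R}^d)$ is sub-exponential and norm-like and there are finite positive constants $b,\delta,K$ not depending on $n$ such that $\mathcal{A}^nV(x)\le-\delta V(x)+b\mathbf{1}_{\overline{B}_0(K)}(x)$ for all $n$ and $x\in\mathbb{R}^d$, and, for each $n$ and all $x\in\widehat{E}^n$, $\mathbb{E}_x\big[\int_0^t\big((1+|\widehat{X}^n(s)|)^4V(\widehat{X}^n(s))\big)^2ds\big]<\infty$ for all $t\ge0$. *)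

theory Defs
  imports "HOL-Probability.Probability"
begin

section \<open>Differential calculus on Euclidean space\<close>

definition grad :: "(real^'d \<Rightarrow> real) \<Rightarrow> real^'d \<Rightarrow> real^'d" where
  "grad f x = (\<chi> i. frechet_derivative f (at x) (axis i 1))"

definition hess :: "(real^'d \<Rightarrow> real) \<Rightarrow> real^'d \<Rightarrow> real^'d^'d" where
  "hess f x = matrix (frechet_derivative (grad f) (at x))"

definition C2 :: "(real^'d \<Rightarrow> real) \<Rightarrow> bool" where
  "C2 f \<longleftrightarrow> (\<forall>x. f differentiable (at x)) \<and> (\<forall>x. grad f differentiable (at x)) \<and>
     continuous_on UNIV (grad f) \<and> continuous_on UNIV (hess f)"

definition norm_like :: "(real^'d \<Rightarrow> real) \<Rightarrow> bool" where
  "norm_like V \<longleftrightarrow> C2 V \<and> filterlim V at_top at_infinity"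

text \<open>The norm of the Hessian is the Euclidean (Frobenius) norm of the matrix.\<close>

definition sub_exponential :: "(real^'d \<Rightarrow> real) \<Rightarrow> bool" where
  "sub_exponential V \<longleftrightarrow> C2 V \<and> (\<forall>x. 1 \<le> V x) \<and>
     (\<exists>c1 c2 c3. \<forall>x. max (norm (grad V x)) (norm (hess V x)) \<le> c1 * exp (c2 * norm x) \<and>
        (\<forall>y. norm y \<le> 1 \<longrightarrow> V (x + y) / V x \<le> c3))"

definition pos_definite :: "real^'d^'d \<Rightarrow> bool" where
  "pos_definite A \<longleftrightarrow> transpose A = A \<and> (\<forall>v. v \<noteq> 0 \<longrightarrow> 0 < v \<bullet> (A *v v))"


section \<open>Continuous time Markov chains\<close>

text \<open>
  A chain is a family of probability measures \<open>M x\<close> (the law \<open>P\<^sub>x\<close> of the chain started in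
  \<open>x \<in> E\<close>) together with random variables \<open>X t\<close>, \<open>t \<ge> 0\<close>, with values in the countable set \<open>E\<close>.
  The \<open>Q\<close>-matrix \<open>q\<close> is stable and conservative, its diagonal being minus the total rate of jumps,
  and is the derivative at time 0 of the transition function
  \<open>p\<^sub>t(x, y) = P\<^sub>x(X\<^sub>t = y)\<close>. Right-continuity of paths refers to the discrete topology on \<open>E\<close>.
\<close>

locale ctmc =
  fixes E :: "'s set" and q :: "'s \<Rightarrow> 's \<Rightarrow> real"
    and M :: "'s \<Rightarrow> 'w measure" and X :: "real \<Rightarrow> 'w \<Rightarrow> 's"
  assumes countable_states: "countable E"
    and states_nonempty: "E \<noteq> {}"
    and rate_nonneg: "\<And>x y. x \<in> E \<Longrightarrow> y \<in> E \<Longrightarrow> x \<noteq> y \<Longrightarrow> 0 \<le> q x y"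
    and conservative: "\<And>x. x \<in> E \<Longrightarrow> (q x has_sum (- q x x)) (E - {x})"
    and prob: "\<And>x. x \<in> E \<Longrightarrow> prob_space (M x)"
    and random_variable: "\<And>x t. x \<in> E \<Longrightarrow> 0 \<le> t \<Longrightarrow> X t \<in> measurable (M x) (count_space E)"
    and initial: "\<And>x. x \<in> E \<Longrightarrow> AE \<omega> in M x. X 0 \<omega> = x"
    and right_continuous: "\<And>x. x \<in> E \<Longrightarrow>
      AE \<omega> in M x. \<forall>t\<ge>0. \<exists>e>0. \<forall>s\<in>{t..<t + e}. X s \<omega> = X t \<omega>"
    and markov: "\<And>x z w s t I y. x \<in> E \<Longrightarrow> z \<in> E \<Longrightarrow> w \<in> E \<Longrightarrow> 0 \<le> s \<Longrightarrow> 0 \<le> t \<Longrightarrow>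
      finite I \<Longrightarrow> I \<subseteq> {0..s} \<Longrightarrow>
      measure (M x) {\<omega> \<in> space (M x). (\<forall>r\<in>I. X r \<omega> = y r) \<and> X s \<omega> = z \<and> X (s + t) \<omega> = w} =
      measure (M x) {\<omega> \<in> space (M x). (\<forall>r\<in>I. X r \<omega> = y r) \<and> X s \<omega> = z} *
      measure (M z) {\<omega> \<in> space (M z). X t \<omega> = w}"
    and rates: "\<And>x y. x \<in> E \<Longrightarrow> y \<in> E \<Longrightarrow>
      ((\<lambda>t. (measure (M x) {\<omega> \<in> space (M x). X t \<omega> = y} - of_bool (x = y)) / t) \<longlongrightarrow> q x y)
        (at_right 0)"

text \<open>Almost surely only finitely many jumps occur in each bounded time interval.\<close>

definition nonexplosive :: "'s set \<Rightarrow> ('s \<Rightarrow> 'w measure) \<Rightarrow> (real \<Rightarrow> 'w \<Rightarrow> 's) \<Rightarrow> bool" where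
  "nonexplosive E M X \<longleftrightarrow> (\<forall>x\<in>E. AE \<omega> in M x.
     \<exists>J :: nat \<Rightarrow> real. J 0 = 0 \<and> strict_mono J \<and> filterlim J at_top sequentially \<and>
       (\<forall>k. \<forall>s\<in>{J k..<J (Suc k)}. X s \<omega> = X (J k) \<omega>))"

definition irreducible_chain :: "'s set \<Rightarrow> ('s \<Rightarrow> 'w measure) \<Rightarrow> (real \<Rightarrow> 'w \<Rightarrow> 's) \<Rightarrow> bool" where
  "irreducible_chain E M X \<longleftrightarrow>
     (\<forall>x\<in>E. \<forall>y\<in>E. \<exists>t\<ge>0. 0 < measure (M x) {\<omega> \<in> space (M x). X t \<omega> = y})"

definition first_jump_time :: "(real \<Rightarrow> 'w \<Rightarrow> 's) \<Rightarrow> 'w \<Rightarrow> ennreal" where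
  "first_jump_time X \<omega> = Inf {ennreal t |t. 0 \<le> t \<and> X t \<omega> \<noteq> X 0 \<omega>}"

definition return_time :: "(real \<Rightarrow> 'w \<Rightarrow> 's) \<Rightarrow> 's \<Rightarrow> 'w \<Rightarrow> ennreal" where
  "return_time X x \<omega> = Inf {ennreal t |t. 0 \<le> t \<and> first_jump_time X \<omega> \<le> ennreal t \<and> X t \<omega> = x}"

text \<open>Absorbing states count as positive recurrent.\<close>

definition positive_recurrent ::
    "'s set \<Rightarrow> ('s \<Rightarrow> 's \<Rightarrow> real) \<Rightarrow> ('s \<Rightarrow> 'w measure) \<Rightarrow> (real \<Rightarrow> 'w \<Rightarrow> 's) \<Rightarrow> bool" where
  "positive_recurrent E q M X \<longleftrightarrow>
     (\<forall>x\<in>E. q x x = 0 \<or> (\<integral>\<^sup>+\<omega>. return_time X x \<omega> \<partial>M x) < \<infinity>)"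


section \<open>The scaled family\<close>

text \<open>\<open>ahat\<close> is the scaled diffusion matrix; \<open>F\<close> and \<open>a\<close> denote the extensions to the whole space.\<close>

definition Fhat :: "(nat \<Rightarrow> real^'d \<Rightarrow> real^'d) \<Rightarrow> (nat \<Rightarrow> real^'d) \<Rightarrow> nat \<Rightarrow> real^'d \<Rightarrow> real^'d" where
  "Fhat F xbar n x = (1 / sqrt (real n)) *\<^sub>R F n (xbar n + sqrt (real n) *\<^sub>R x)"

definition ahat :: "(nat \<Rightarrow> real^'d \<Rightarrow> real^'d^'d) \<Rightarrow> (nat \<Rightarrow> real^'d) \<Rightarrow> nat \<Rightarrow> real^'d \<Rightarrow> real^'d^'d" where
  "ahat a xbar n x = (1 / real n) *\<^sub>R a n (xbar n + sqrt (real n) *\<^sub>R x)"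

definition Xhat :: "(nat \<Rightarrow> real \<Rightarrow> 'w \<Rightarrow> real^'d) \<Rightarrow> (nat \<Rightarrow> real^'d) \<Rightarrow> nat \<Rightarrow> real \<Rightarrow> 'w \<Rightarrow> real^'d" where
  "Xhat X xbar n t \<omega> = (1 / sqrt (real n)) *\<^sub>R (X n t \<omega> - xbar n)"

definition Ehat :: "(nat \<Rightarrow> (real^'d) set) \<Rightarrow> (nat \<Rightarrow> real^'d) \<Rightarrow> nat \<Rightarrow> (real^'d) set" where
  "Ehat E xbar n = (\<lambda>y. (1 / sqrt (real n)) *\<^sub>R (y - xbar n)) ` E n"

definition generator :: "(nat \<Rightarrow> real^'d \<Rightarrow> real^'d) \<Rightarrow> (nat \<Rightarrow> real^'d \<Rightarrow> real^'d^'d) \<Rightarrow>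
    (nat \<Rightarrow> real^'d) \<Rightarrow> nat \<Rightarrow> (real^'d \<Rightarrow> real) \<Rightarrow> real^'d \<Rightarrow> real" where
  "generator F a xbar n f x =
     (\<Sum>i\<in>UNIV. Fhat F xbar n x $ i * grad f x $ i) +
     1 / 2 * (\<Sum>i\<in>UNIV. \<Sum>j\<in>UNIV. ahat a xbar n 0 $ i $ j * hess f x $ i $ j)"

text \<open>The set of jump sizes contains 0 so that its supremum is meaningful even without jumps.\<close>

definition jump_sizes :: "nat \<Rightarrow> (nat \<Rightarrow> (real^'d) set) \<Rightarrow>
    (nat \<Rightarrow> real^'d \<Rightarrow> real^'d \<Rightarrow> real) \<Rightarrow> real set" where
  "jump_sizes n0 E \<beta> = insert 0 {norm l |l n x. n0 \<le> n \<and> x \<in> E n \<and> 0 < \<beta> n l x}"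

text \<open>
  The standing assumptions. The scaling parameter \<open>n\<close> ranges over \<open>n \<ge> n0\<close>, where \<open>n0\<close> is so
  large that the scaled jumps have norm at most 1. \<open>\<beta> n l x\<close> is the rate of the jump \<open>l\<close> from \<open>x\<close>;
  \<open>\<beta> n 0 x\<close> is the diagonal entry of the \<open>Q\<close>-matrix and does not contribute to \<open>F\<close> and \<open>a\<close>.
\<close>

locale scaled_ctmc_family =
  fixes n0 :: nat
    and E :: "nat \<Rightarrow> (real^'d) set"
    and \<beta> :: "nat \<Rightarrow> real^'d \<Rightarrow> real^'d \<Rightarrow> real"
    and M :: "nat \<Rightarrow> real^'d \<Rightarrow> 'w measure"
    and X :: "nat \<Rightarrow> real \<Rightarrow> 'w \<Rightarrow> real^'d"
    and F :: "nat \<Rightarrow> real^'d \<Rightarrow> real^'d"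
    and a :: "nat \<Rightarrow> real^'d \<Rightarrow> real^'d^'d"
    and xbar :: "nat \<Rightarrow> real^'d"
  assumes n0_pos: "1 \<le> n0"
    and chain: "\<And>n. n0 \<le> n \<Longrightarrow> ctmc (E n) (\<lambda>x y. \<beta> n (y - x) x) (M n) (X n)"
    and jumps_stay: "\<And>n x l. n0 \<le> n \<Longrightarrow> x \<in> E n \<Longrightarrow> x + l \<notin> E n \<Longrightarrow> \<beta> n l x = 0"
    and nonexpl: "\<And>n. n0 \<le> n \<Longrightarrow> nonexplosive (E n) (M n) (X n)"
    and irred: "\<And>n. n0 \<le> n \<Longrightarrow> irreducible_chain (E n) (M n) (X n)"
    and pos_rec: "\<And>n. n0 \<le> n \<Longrightarrow>
      positive_recurrent (E n) (\<lambda>x y. \<beta> n (y - x) x) (M n) (X n)"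
    and drift: "\<And>n x. n0 \<le> n \<Longrightarrow> x \<in> E n \<Longrightarrow> ((\<lambda>l. \<beta> n l x *\<^sub>R l) has_sum F n x) UNIV"
    and diffusion: "\<And>n x i j. n0 \<le> n \<Longrightarrow> x \<in> E n \<Longrightarrow>
      ((\<lambda>l. l $ i * l $ j * \<beta> n l x) has_sum a n x $ i $ j) UNIV"
    and equilibrium: "\<And>n. n0 \<le> n \<Longrightarrow> F n (xbar n) = 0"
    and equilibrium_unique: "\<And>n y. n0 \<le> n \<Longrightarrow> F n y = 0 \<Longrightarrow> y = xbar n"
    and jumps_bounded: "bdd_above (jump_sizes n0 E \<beta>)"
    and scaled_jumps: "\<And>n. n0 \<le> n \<Longrightarrow> Sup (jump_sizes n0 E \<beta>) / sqrt (real n) \<le> 1"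
    and F_lipschitz: "\<exists>K_F. \<forall>n\<ge>n0. \<forall>x y.
      norm (Fhat F xbar n x - Fhat F xbar n y) \<le> K_F * norm (x - y)"
    and a_lipschitz: "\<exists>K_a. \<forall>n\<ge>n0. \<forall>x.
      norm (ahat a xbar n x - ahat a xbar n 0) \<le> K_a / sqrt (real n) * norm x"
    and a_pos_definite: "\<And>n. n0 \<le> n \<Longrightarrow> pos_definite (ahat a xbar n 0)"
    and a_limit: "\<exists>abar. pos_definite abar \<and> (\<lambda>n. ahat a xbar n 0) \<longlonglongrightarrow> abar"

text \<open>The law of the scaled chain started in \<open>x\<close> is the law of the chain started in
  \<open>xbar n + sqrt n *\<^sub>R x\<close>.\<close>

definition finite_moments :: "nat \<Rightarrow> (nat \<Rightarrow> (real^'d) set) \<Rightarrow> (nat \<Rightarrow> real^'d \<Rightarrow> 'w measure) \<Rightarrow>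
    (nat \<Rightarrow> real \<Rightarrow> 'w \<Rightarrow> real^'d) \<Rightarrow> (nat \<Rightarrow> real^'d) \<Rightarrow> (real^'d \<Rightarrow> real) \<Rightarrow> bool" where
  "finite_moments n0 E M X xbar V \<longleftrightarrow>
     (\<forall>n\<ge>n0. \<forall>x\<in>Ehat E xbar n. \<forall>t\<ge>0.
        (\<integral>\<^sup>+\<omega>. (\<integral>\<^sup>+s\<in>{0..t}.
            ennreal (((1 + norm (Xhat X xbar n s \<omega>)) ^ 4 * V (Xhat X xbar n s \<omega>))\<^sup>2) \<partial>lborel)
          \<partial>M n (xbar n + sqrt (real n) *\<^sub>R x)) < \<infinity>)"

definition UL_A :: "nat \<Rightarrow> (nat \<Rightarrow> (real^'d) set) \<Rightarrow> (nat \<Rightarrow> real^'d \<Rightarrow> 'w measure) \<Rightarrow>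
    (nat \<Rightarrow> real \<Rightarrow> 'w \<Rightarrow> real^'d) \<Rightarrow> (nat \<Rightarrow> real^'d \<Rightarrow> real^'d) \<Rightarrow>
    (nat \<Rightarrow> real^'d \<Rightarrow> real^'d^'d) \<Rightarrow> (nat \<Rightarrow> real^'d) \<Rightarrow> (real^'d \<Rightarrow> real) \<Rightarrow> bool" where
  "UL_A n0 E M X F a xbar V \<longleftrightarrow>
     C2 V \<and> sub_exponential V \<and> norm_like V \<and>
     (\<exists>b \<delta> K :: real. 0 < b \<and> 0 < \<delta> \<and> 0 < K \<and>
        (\<forall>n\<ge>n0. \<forall>x. generator F a xbar n V x \<le> - \<delta> * V x + b * indicator (cball 0 K) x)) \<and>
     finite_moments n0 E M X xbar V"

end

theory Submission
  imports Defs
begin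

text \<open>The generator is the drift term \<open>Fhat F xbar n x \<bullet> grad V x\<close> plus
  half the Frobenius inner product of \<open>ahat a xbar n 0\<close> with the Hessian
  (\<open>generator_eq\<close>). The drift term supplies the decay
  \<open>- \<eta> * (V x - V 0)\<close>. The matrices converge, so their norms have a common bound
  C, and by Cauchy-Schwarz the second-order term is at most \<open>C / 2 * norm (hess V x)\<close>.
  Far from 0 this term and \<open>\<eta> * V 0\<close> are small fractions of
  \<open>\<eta> * V x\<close>, since V grows to infinity and dominates its Hessian; half of the
  decay survives. On the remaining ball the Hessian is bounded
  (\<open>C2_hess_bounded_cball\<close>), and the constant b absorbs the error. C, the radius and b
  do not depend on n.\<close>

lemma generator_eq:
  "generator F a xbar n f x =
     Fhat F xbar n x \<bullet> grad f x + 1 / 2 * (ahat a xbar n 0 \<bullet> hess f x)"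
  by (simp add: generator_def inner_vec_def)

text \<open>A continuous Hessian maps the compact ball to a bounded set.\<close>

lemma C2_hess_bounded_cball:
  fixes f :: "real^'d \<Rightarrow> real"
  assumes "C2 f"
  obtains B where "0 \<le> B" "\<And>x. norm x \<le> r \<Longrightarrow> norm (hess f x) \<le> B"
proof -
  have "continuous_on (cball 0 r) (hess f)"
    using assms continuous_on_subset unfolding C2_def by blast
  then have "bounded (hess f ` cball 0 r)"
    by (intro compact_imp_bounded compact_continuous_image) auto
  then obtain B where "0 < B" "\<forall>y\<in>hess f ` cball 0 r. norm y \<le> B"
    unfolding bounded_pos by blast
  then show thesis
    by (intro that[of B]) auto
qed

theorem lemma3p1:
  fixes n0 :: nat
    and E :: "nat \<Rightarrow> (real^'d) set"
    and \<beta> :: "nat \<Rightarrow> real^'d \<Rightarrow> real^'d \<Rightarrow> real"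
    and M :: "nat \<Rightarrow> real^'d \<Rightarrow> 'w measure"
    and X :: "nat \<Rightarrow> real \<Rightarrow> 'w \<Rightarrow> real^'d"
    and F :: "nat \<Rightarrow> real^'d \<Rightarrow> real^'d"
    and a :: "nat \<Rightarrow> real^'d \<Rightarrow> real^'d^'d"
    and xbar :: "nat \<Rightarrow> real^'d"
    and V :: "real^'d \<Rightarrow> real"
    and \<eta> :: real
  assumes "scaled_ctmc_family n0 E \<beta> M X F a xbar"
    and "C2 V" and "sub_exponential V" and "norm_like V"
    and "finite_moments n0 E M X xbar V"
    and "0 < \<eta>"
    and "\<And>n x. n0 \<le> n \<Longrightarrow> x \<noteq> 0 \<Longrightarrow>
      V 0 < V x \<and> Fhat F xbar n x \<bullet> grad V x \<le> - \<eta> * (V x - V 0)"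
    and "Limsup at_infinity (\<lambda>x. ereal (norm (hess V x) / V x)) = 0"
  shows "(\<exists>b \<delta> K :: real. 0 < b \<and> 0 < \<delta> \<and> 0 < K \<and>
      (\<forall>n\<ge>n0. \<forall>x. generator F a xbar n V x \<le> - \<delta> * V x + b * indicator (cball 0 K) x)) \<and>
    UL_A n0 E M X F a xbar V"
proof -
  interpret scaled_ctmc_family n0 E \<beta> M X F a xbar
    by fact
  obtain C where "0 < C" and C: "\<And>n. norm (ahat a xbar n 0) \<le> C"
    using a_limit convergent_def convergent_imp_Bseq BseqE by metis
  have "0 < V 0"
    using assms(3) less_le_trans[OF zero_less_one] unfolding sub_exponential_def by blast
  have drift_le: "Fhat F xbar n x \<bullet> grad V x \<le> - \<eta> * (V x - V 0)" if "n0 \<le> n" for n x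
  proof (cases "x = 0")
    \<comment> \<open>The hypothesis covers only nonzero points; at 0 both sides vanish, because
      \<open>xbar n\<close> is the zero of \<open>F n\<close>.\<close>
    case True
    then show ?thesis
      by (simp add: Fhat_def equilibrium[OF that])
  qed (use assms(7) that in blast)
  have gen_le: "generator F a xbar n V x \<le> - \<eta> * (V x - V 0) + C / 2 * norm (hess V x)"
    if "n0 \<le> n" for n x
  proof -
    have "ahat a xbar n 0 \<bullet> hess V x \<le> C * norm (hess V x)"
      using norm_cauchy_schwarz C mult_right_mono norm_ge_zero by (meson order_trans)
    then show ?thesis
      using drift_le[OF that, of x] by (simp add: generator_eq)
  qed
  \<comment> \<open>The thresholds \<open>4 * V 0\<close> and \<open>\<eta> / (2 * C)\<close> make
    each of the two error terms at most \<open>\<eta> / 4 * V x\<close>, leaving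
    \<open>- (\<eta> / 2) * V x\<close>.\<close>
  have V_large: "\<forall>\<^sub>F x in at_infinity. 4 * V 0 \<le> V x"
    using assms(4) unfolding norm_like_def filterlim_at_top by blast
  have "\<forall>\<^sub>F x in at_infinity. ereal (norm (hess V x) / V x) < ereal (\<eta> / (2 * C))"
    using assms(6) \<open>0 < C\<close> by (intro Limsup_lessD) (simp add: assms(8))
  with V_large have
    "\<forall>\<^sub>F x in at_infinity. 4 * V 0 \<le> V x \<and> norm (hess V x) / V x < \<eta> / (2 * C)"
    by eventually_elim simp
  then obtain r where r:
    "\<And>x. r \<le> norm x \<Longrightarrow> 4 * V 0 \<le> V x \<and> norm (hess V x) / V x < \<eta> / (2 * C)"
    unfolding eventually_at_infinity by blast
  \<comment> \<open>The maximum ensures a positive radius, as r may have any sign.\<close>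
  define K where "K = max r 1"
  obtain B where "0 \<le> B" and B: "\<And>x. norm x \<le> K \<Longrightarrow> norm (hess V x) \<le> B"
    using C2_hess_bounded_cball[OF assms(2)] by blast
  define b where "b = \<eta> * V 0 + C / 2 * B"
  have "0 < b"
    using assms(6) \<open>0 < V 0\<close> \<open>0 < C\<close> \<open>0 \<le> B\<close> by (simp add: b_def add_pos_nonneg)
  have V_nonneg: "0 \<le> V x" for x
    using assms(3) order_trans[OF zero_le_one] unfolding sub_exponential_def by blast
  have "generator F a xbar n V x \<le> - (\<eta> / 2) * V x + b * indicator (cball 0 K) x"
    if "n0 \<le> n" for n x
  proof (cases "norm x \<le> K")
    case True
    have "C / 2 * norm (hess V x) \<le> C / 2 * B"
      using B[OF True] \<open>0 < C\<close> by simp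
    \<comment> \<open>This lets \<open>- \<eta> * V x\<close> be weakened to the rate
      \<open>\<eta> / 2\<close> that holds outside the ball.\<close>
    moreover have "0 \<le> \<eta> * V x"
      using V_nonneg assms(6) by simp
    ultimately have "generator F a xbar n V x \<le> - (\<eta> / 2) * V x + b"
      using gen_le[OF that, of x] by (simp add: b_def algebra_simps)
    with True show ?thesis
      by (simp add: indicator_def)
  next
    case False
    with r have V4: "4 * V 0 \<le> V x" and H: "norm (hess V x) / V x < \<eta> / (2 * C)"
      by (auto simp: K_def)
    have "\<eta> * (4 * V 0) \<le> \<eta> * V x"
      using V4 assms(6) by (intro mult_left_mono) auto
    \<comment> \<open>Clearing the denominator in \<open>H\<close> is sound because
      \<open>V x\<close> is at least \<open>4 * V 0\<close>, which is positive.\<close>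
    moreover have "C / 2 * norm (hess V x) \<le> \<eta> / 4 * V x"
      using H V4 \<open>0 < V 0\<close> \<open>0 < C\<close> by (simp add: field_simps)
    ultimately have "generator F a xbar n V x \<le> - (\<eta> / 2) * V x"
      using gen_le[OF that, of x] by (simp add: algebra_simps)
    with False show ?thesis
      by (simp add: indicator_def)
  qed
  moreover have "0 < \<eta> / 2" "0 < K"
    using assms(6) by (auto simp: K_def)
  ultimately have "\<exists>b \<delta> K :: real. 0 < b \<and> 0 < \<delta> \<and> 0 < K \<and>
      (\<forall>n\<ge>n0. \<forall>x. generator F a xbar n V x \<le> - \<delta> * V x + b * indicator (cball 0 K) x)"
    using \<open>0 < b\<close> by blast
  then show ?thesis
    using assms(2-5) unfolding UL_A_def by blast
qed

end
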